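(* Let $S=\begin{pmatrix}a&b\\c&d\end{pmatrix}$ and $T=\begin{pmatrix}\lambda&0\\0&\mu\end{pmatrix}$ be elements of $\mathrm{SL}(2,\mathbb H)$, where $\lambda$ is not similar to $\mu$, that generate a discrete non-elementary subgroup $\langle S,T\rangle$ of $\mathrm{SL}(2,\mathbb H)$. Then $$2(\cosh\tau-\cos(\alpha+\beta))(1+|bc|)\ \ge\ 1,$$ where $\alpha=\arg(\lambda)$, $\beta=\arg(\mu)$ and $\tau=2\log|\lambda|$.
   Context: $\mathbb H$ is the division ring of real quaternions. For $q=q_0+q_1i+q_2j+q_3k\in\mathbb H$ ($q_0,\dots,q_3\in\mathbb R$): $\Re q=q_0$, $\Im q=q_1i+q_2j+q_3k$, $\overline q=\Re q-\Im q$, $|q|=\sqrt{q_0^2+q_1^2+q_2^2+q_3^2}$. Two quaternions $p,q$ are similar if $q=u^{-1}pu$ for some nonzero $u\in\mathbb H$; equivalently $\Re p=\Re q$ and $|p|=|q|$. Every nonzero quaternion $q$ is similar to a complex number $re^{i\theta}$ with $r=|q|$ and a unique $\theta\in[0,\pi]$; this $\theta$ is denoted $\arg(q)$. For a $2\times2$ quaternionic matrix $A=\begin{pmatrix}a&b\\c&d\end{pmatrix}$, $\det A=\sqrt{|a|^2|d|^2+|b|^2|c|^2-2\Re(a\overline c d\overline b)}$ (which equals $|ad-aca^{-1}b|$ when $a\ne0$); $\mathrm{SL}(2,\mathbb H)$ is the group of such matrices with $\det=1$. It acts on $\widehat{\mathbb H}=\mathbb H\cup\{\infty\}$ by $Z\mapsto(aZ+b)(cZ+d)^{-1}$,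 and by Poincaré extension on hyperbolic 5-space $\mathbf H^5$ (with boundary $\widehat{\mathbb H}$) by orientation-preserving isometries. A subgroup is elementary if it has a finite orbit in $\mathbf H^5\cup\widehat{\mathbb H}$, and non-elementary otherwise. *)

theory Defs
  imports "HOL-Analysis.Analysis" "HOL-Algebra.Generated_Groups"
begin

section \<open>The normed division algebra of real quaternions\<close>

datatype quat = Quat (qre: real) (qi: real) (qj: real) (qk: real)

lemma quat_eq_iff:
  "p = q \<longleftrightarrow> qre p = qre q \<and> qi p = qi q \<and> qj p = qj q \<and> qk p = qk q"
  by (cases p; cases q) auto

definition qcnj :: "quat \<Rightarrow> quat" where
  "qcnj q = Quat (qre q) (- qi q) (- qj q) (- qk q)"

lemma qcnj_sel [simp]:
  "qre (qcnj q) = qre q" "qi (qcnj q) = - qi q" "qj (qcnj q) = - qj q" "qk (qcnj q) = - qk q"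
  by (simp_all add: qcnj_def)

instantiation quat :: real_vector
begin

definition "0 = Quat 0 0 0 0"
definition "p + q = Quat (qre p + qre q) (qi p + qi q) (qj p + qj q) (qk p + qk q)"
definition "- q = Quat (- qre q) (- qi q) (- qj q) (- qk q)"
definition "p - q = Quat (qre p - qre q) (qi p - qi q) (qj p - qj q) (qk p - qk q)"
definition "r *\<^sub>R q = Quat (r * qre q) (r * qi q) (r * qj q) (r * qk q)"

lemma quat_vector_sel [simp]:
  "qre 0 = 0" "qi 0 = 0" "qj 0 = 0" "qk 0 = 0"
  "qre (p + q) = qre p + qre q" "qi (p + q) = qi p + qi q"
  "qj (p + q) = qj p + qj q" "qk (p + q) = qk p + qk q"
  "qre (- q) = - qre q" "qi (- q) = - qi q" "qj (- q) = - qj q" "qk (- q) = - qk q"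
  "qre (p - q) = qre p - qre q" "qi (p - q) = qi p - qi q"
  "qj (p - q) = qj p - qj q" "qk (p - q) = qk p - qk q"
  "qre (r *\<^sub>R q) = r * qre q" "qi (r *\<^sub>R q) = r * qi q"
  "qj (r *\<^sub>R q) = r * qj q" "qk (r *\<^sub>R q) = r * qk q"
  by (simp_all add: zero_quat_def plus_quat_def uminus_quat_def minus_quat_def scaleR_quat_def)

instance
  by standard (simp_all add: quat_eq_iff algebra_simps)

end

instantiation quat :: real_inner
begin

definition "inner p q = qre p * qre q + qi p * qi q + qj p * qj q + qk p * qk q"
definition "norm q = sqrt ((qre q)\<^sup>2 + (qi q)\<^sup>2 + (qj q)\<^sup>2 + (qk q)\<^sup>2)"
definition "sgn (q :: quat) = q /\<^sub>R norm q"
definition "dist (p :: quat) q = norm (p - q)"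
definition "(uniformity :: (quat \<times> quat) filter) =
  (INF e\<in>{0 <..}. principal {(x, y). dist x y < e})"
definition "open (U :: quat set) \<longleftrightarrow>
  (\<forall>x\<in>U. eventually (\<lambda>(x', y). x' = x \<longrightarrow> y \<in> U) uniformity)"

instance
proof
  fix x y z :: quat and r :: real
  show "inner x y = inner y x"
    by (simp add: inner_quat_def mult.commute)
  show "inner (x + y) z = inner x z + inner y z"
    by (simp add: inner_quat_def algebra_simps)
  show "inner (r *\<^sub>R x) y = r * inner x y"
    by (simp add: inner_quat_def algebra_simps)
  show "0 \<le> inner x x"
    by (simp add: inner_quat_def)
  show "inner x x = 0 \<longleftrightarrow> x = 0"
    by (simp add: inner_quat_def quat_eq_iff add_nonneg_eq_0_iff)
  show "norm x = sqrt (inner x x)"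
    by (simp add: inner_quat_def norm_quat_def power2_eq_square)
qed (rule sgn_quat_def dist_quat_def open_quat_def uniformity_quat_def)+

end

lemma norm_quat_squared:
  "(norm q)\<^sup>2 = (qre q)\<^sup>2 + (qi q)\<^sup>2 + (qj q)\<^sup>2 + (qk q)\<^sup>2"
  by (simp add: norm_quat_def)

instantiation quat :: real_normed_div_algebra
begin

definition "1 = Quat 1 0 0 0"
definition "p * q = Quat
  (qre p * qre q - qi p * qi q - qj p * qj q - qk p * qk q)
  (qre p * qi q + qi p * qre q + qj p * qk q - qk p * qj q)
  (qre p * qj q - qi p * qk q + qj p * qre q + qk p * qi q)
  (qre p * qk q + qi p * qj q - qj p * qi q + qk p * qre q)"
definition "inverse q = qcnj q /\<^sub>R (norm q)\<^sup>2"
definition "(p :: quat) div q = p * inverse q"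

lemma quat_one_sel [simp]: "qre 1 = 1" "qi 1 = 0" "qj 1 = 0" "qk 1 = 0"
  by (simp_all add: one_quat_def)

lemma quat_times_sel:
  "qre (p * q) = qre p * qre q - qi p * qi q - qj p * qj q - qk p * qk q"
  "qi (p * q) = qre p * qi q + qi p * qre q + qj p * qk q - qk p * qj q"
  "qj (p * q) = qre p * qj q - qi p * qk q + qj p * qre q + qk p * qi q"
  "qk (p * q) = qre p * qk q + qi p * qj q - qj p * qi q + qk p * qre q"
  by (simp_all add: times_quat_def)

instance
proof
  fix x y z :: quat and r :: real
  show "(x * y) * z = x * (y * z)"
    by (simp add: quat_eq_iff quat_times_sel algebra_simps)
  show "(x + y) * z = x * z + y * z" "x * (y + z) = x * y + x * z"
    by (simp_all add: quat_eq_iff quat_times_sel algebra_simps)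
  show "1 * x = x" "x * 1 = x"
    by (simp_all add: quat_eq_iff quat_times_sel)
  show "(0 :: quat) \<noteq> 1"
    by (simp add: quat_eq_iff)
  show "(r *\<^sub>R x) * y = r *\<^sub>R (x * y)" "x * (r *\<^sub>R y) = r *\<^sub>R (x * y)"
    by (simp_all add: quat_eq_iff quat_times_sel algebra_simps)
  have cnj: "qcnj q * q = (norm q)\<^sup>2 *\<^sub>R 1" "q * qcnj q = (norm q)\<^sup>2 *\<^sub>R 1" for q :: quat
    unfolding norm_quat_squared
    by (simp_all add: quat_eq_iff quat_times_sel power2_eq_square)
  have scl: "(s *\<^sub>R p) * q = s *\<^sub>R (p * q)" "p * (s *\<^sub>R q) = s *\<^sub>R (p * q)" for s and p q :: quat
    by (simp_all add: quat_eq_iff quat_times_sel algebra_simps)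
  show "inverse x * x = 1" "x * inverse x = 1" if "x \<noteq> 0"
    using that by (simp_all add: inverse_quat_def scl cnj)
  show "x div y = x * inverse y"
    by (rule divide_quat_def)
  show "inverse (0 :: quat) = 0"
    by (simp add: inverse_quat_def)
  have "(norm (x * y))\<^sup>2 = (norm x * norm y)\<^sup>2"
    unfolding power_mult_distrib norm_quat_squared quat_times_sel by algebra
  then show "norm (x * y) = norm x * norm y"
    by (simp add: power2_eq_iff_nonneg)
qed

end

definition quat_of_complex :: "complex \<Rightarrow> quat" where
  "quat_of_complex z = Quat (Re z) (Im z) 0 0"

definition similar :: "quat \<Rightarrow> quat \<Rightarrow> bool" where
  "similar p q \<longleftrightarrow> (\<exists>u. u \<noteq> 0 \<and> q = inverse u * p * u)"

text \<open>Only meaningful for \<open>q \<noteq> 0\<close>; \<open>rcis r \<theta>\<close> is the complex number $r e^{i\theta}$.\<close>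

definition qarg :: "quat \<Rightarrow> real" where
  "qarg q = (THE \<theta>. 0 \<le> \<theta> \<and> \<theta> \<le> pi \<and> similar q (quat_of_complex (rcis (norm q) \<theta>)))"


section \<open>The group SL(2,H) and its actions\<close>

definition qmat :: "quat \<Rightarrow> quat \<Rightarrow> quat \<Rightarrow> quat \<Rightarrow> quat^2^2" where
  "qmat a b c d = vector [vector [a, b], vector [c, d]]"

definition qdet :: "quat^2^2 \<Rightarrow> real" where
  "qdet A = (let a = A$1$1; b = A$1$2; c = A$2$1; d = A$2$2 in
     sqrt ((norm a)\<^sup>2 * (norm d)\<^sup>2 + (norm b)\<^sup>2 * (norm c)\<^sup>2
           - 2 * qre (a * qcnj c * d * qcnj b)))"

definition SL2H :: "(quat^2^2) monoid" where
  "SL2H = \<lparr>carrier = {A. qdet A = 1}, mult = (**), one = mat 1\<rparr>"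

text \<open>The action on the boundary, where \<open>None\<close> stands for $\infty$.\<close>

definition moebius :: "quat^2^2 \<Rightarrow> quat option \<Rightarrow> quat option" where
  "moebius A Z = (let a = A$1$1; b = A$1$2; c = A$2$1; d = A$2$2 in
     case Z of
       None \<Rightarrow> if c = 0 then None else Some (a * inverse c)
     | Some z \<Rightarrow> if c * z + d = 0 then None else Some ((a * z + b) * inverse (c * z + d)))"

text \<open>
  Hyperbolic 5-space is the upper half-space of points \<open>(z, t)\<close> with \<open>z\<close> a quaternion and
  \<open>t > 0\<close>. The Poincare extension of the Moebius map of \<open>A\<close> with \<open>qdet A = 1\<close> is given by the
  classical formula
  $$(z,t) \mapsto \left(\frac{(az+b)\overline{(cz+d)} + a\overline{c}\,t^2}{|cz+d|^2+|c|^2t^2},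
    \frac{t}{|cz+d|^2+|c|^2t^2}\right),$$
  which for \<open>t = 0\<close> restricts to the boundary action.
\<close>

definition hyp5 :: "(quat \<times> real) set" where
  "hyp5 = {(z, t). t > 0}"

definition poincare_ext :: "quat^2^2 \<Rightarrow> quat \<times> real \<Rightarrow> quat \<times> real" where
  "poincare_ext A p = (let a = A$1$1; b = A$1$2; c = A$2$1; d = A$2$2; z = fst p; t = snd p;
       D = (norm (c * z + d))\<^sup>2 + (norm c)\<^sup>2 * t\<^sup>2 in
     (((a * z + b) * qcnj (c * z + d) + t\<^sup>2 *\<^sub>R (a * qcnj c)) /\<^sub>R D, t / D))"

lemma poincare_ext_boundary:
  assumes "A$2$1 * z + A$2$2 \<noteq> 0"
  shows "poincare_ext A (z, 0) = (the (moebius A (Some z)), 0)"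
  using assms
  by (simp add: poincare_ext_def moebius_def Let_def inverse_quat_def)

text \<open>
  A finite orbit in the union of \<open>hyp5\<close> and its boundary lies in one of the two parts, since the
  group preserves both.
\<close>

definition elementary :: "(quat^2^2) set \<Rightarrow> bool" where
  "elementary G \<longleftrightarrow>
     (\<exists>p\<in>hyp5. finite ((\<lambda>A. poincare_ext A p) ` G)) \<or>
     (\<exists>Z. finite ((\<lambda>A. moebius A Z) ` G))"

end

(* With T = diag(lam, mu), conjugate repeatedly: A_0 = S and A_{n+1} = A_n T A_n^{-1}. Write
   a_n, b_n, c_n, d_n for the entries of A_n. Then |b_{n+1}| is |a_n b_n| times the distance between
   a conjugate of lam and a conjugate of mu, and the square of such a distance is at most
   K = 2 (cosh tau - cos (alpha + beta)); similarly for c_{n+1}. As |a_n d_n| <= 1 + |b_n c_n|, the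
   inequality K (1 + |bc|) < 1 makes b_n c_n tend to 0 geometrically, hence |a_n| and |d_n| are
   asymptotically bounded by |lam| and |mu|, and T^{-n} A_{2n} T^n stays bounded with off-diagonal
   entries tending to 0. By discreteness some A_N is diagonal. Since lam and mu are not similar,
   b_{n+1} = c_{n+1} = 0 forces A_n to be diagonal or antidiagonal, and for n > 0 the latter is
   excluded by the real part of the trace, so S is diagonal or antidiagonal and the group preserves
   {0, infinity}. *)
theory Submission
  imports Defs
begin

section \<open>Quaternions\<close>

lemma qcnj_mult: "qcnj (p * q) = qcnj q * qcnj p"
  and qcnj_add: "qcnj (p + q) = qcnj p + qcnj q"
  and qcnj_scaleR: "qcnj (r *\<^sub>R p) = r *\<^sub>R qcnj p"
  and qcnj_qcnj [simp]: "qcnj (qcnj p) = p"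
  by (simp_all add: quat_eq_iff quat_times_sel algebra_simps)

lemma qcnj_zero [simp]: "qcnj 0 = 0"
  by (simp add: quat_eq_iff)

lemma norm_qcnj [simp]: "norm (qcnj p) = norm p"
  by (simp add: norm_quat_def)

lemma mult_qcnj [simp]: "q * qcnj q = (norm q)\<^sup>2 *\<^sub>R 1"
  and qcnj_mult_self [simp]: "qcnj q * q = (norm q)\<^sup>2 *\<^sub>R 1"
  unfolding norm_quat_squared
  by (simp_all add: quat_eq_iff quat_times_sel power2_eq_square algebra_simps)

lemma mult_qcnj_left [simp]: "q * (qcnj q * x) = (norm q)\<^sup>2 *\<^sub>R x"
  and qcnj_mult_left [simp]: "qcnj q * (q * x) = (norm q)\<^sup>2 *\<^sub>R x"
  by (simp_all flip: mult.assoc)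

lemma qre_mult_commute: "qre (p * q) = qre (q * p)"
  by (simp add: quat_times_sel algebra_simps)

lemma norm_add_squared: "(norm (p + q))\<^sup>2 = (norm p)\<^sup>2 + (norm q)\<^sup>2 + 2 * qre (p * qcnj q)"
  unfolding norm_quat_squared by (simp add: quat_times_sel power2_eq_square algebra_simps)

lemma norm_diff_squared: "(norm (p - q))\<^sup>2 = (norm p)\<^sup>2 + (norm q)\<^sup>2 - 2 * qre (p * qcnj q)"
  unfolding norm_quat_squared by (simp add: quat_times_sel power2_eq_square algebra_simps)

lemma norm_conjugate: "u \<noteq> 0 \<Longrightarrow> norm (u * q * inverse u) = norm (q :: quat)"
  by (simp add: norm_mult norm_inverse)

lemma qre_conjugate:
  assumes "u \<noteq> 0"
  shows "qre (u * q * inverse u) = qre q"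
proof -
  have "qre (u * q * inverse u) = qre (inverse u * u * q)"
    unfolding mult.assoc[of "inverse u"] by (rule qre_mult_commute)
  then show ?thesis
    using assms by simp
qed

text \<open>Finite dimension provides convergent subsequences of bounded sequences in
  \<open>quat^2^2\<close>, on which \<open>discrete_subgroup_subsequence\<close> rests.\<close>

instantiation quat :: euclidean_space
begin

definition "Basis = {Quat 1 0 0 0, Quat 0 1 0 0, Quat 0 0 1 0, Quat 0 0 0 1}"

instance
proof
  show "(Basis :: quat set) \<noteq> {}" "finite (Basis :: quat set)"
    by (simp_all add: Basis_quat_def)
  show "inner u v = (if u = v then 1 else 0)" if "u \<in> Basis" "v \<in> Basis" for u v :: quat
    using that unfolding Basis_quat_def by (elim insertE emptyE) (simp_all add: inner_quat_def)
  show "(\<forall>u\<in>Basis. inner x u = 0) \<longleftrightarrow> x = 0" for x :: quat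
    by (simp add: Basis_quat_def inner_quat_def quat_eq_iff[of x 0])
qed

end

lemma qcnj_tendsto [tendsto_intros]:
  assumes "(f \<longlongrightarrow> l) F"
  shows "((\<lambda>x. qcnj (f x)) \<longlongrightarrow> qcnj l) F"
proof -
  have "bounded_linear qcnj"
    by (rule bounded_linear_intro[where K = 1]) (simp_all add: qcnj_add qcnj_scaleR)
  then show ?thesis
    using assms by (rule bounded_linear.tendsto)
qed

section \<open>Similarity and the argument of a quaternion\<close>

lemma similarI:
  assumes "u \<noteq> 0" "p * u = u * q"
  shows "similar p q"
proof -
  have "inverse u * p * u = q"
    using assms by (simp add: mult.assoc) (simp flip: mult.assoc)
  then show ?thesis
    using assms(1) unfolding similar_def by auto
qed

text \<open>Equal real parts and norms give imaginary parts \<open>P\<close>, \<open>Q\<close> whose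
  squares are the same real number, so every u = P w + w Q satisfies p u = u q. A nonzero such u
  realizes the similarity.\<close>

lemma similar_iff: "similar p q \<longleftrightarrow> qre p = qre q \<and> norm p = norm q"
proof
  assume "similar p q"
  then obtain u where u: "u \<noteq> 0" "q = inverse u * p * u"
    unfolding similar_def by auto
  then show "qre p = qre q \<and> norm p = norm q"
    using qre_conjugate[of "inverse u" p] norm_conjugate[of "inverse u" p] by simp
next
  assume *: "qre p = qre q \<and> norm p = norm q"
  define P Q where "P = p - qre p *\<^sub>R 1" and "Q = q - qre q *\<^sub>R 1"
  have "(qi p)\<^sup>2 + (qj p)\<^sup>2 + (qk p)\<^sup>2 = (qi q)\<^sup>2 + (qj q)\<^sup>2 + (qk q)\<^sup>2"
    using * norm_quat_squared[of p] norm_quat_squared[of q] by simp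
  then have sq: "P * P = - (norm P)\<^sup>2 *\<^sub>R 1" "Q * Q = - (norm P)\<^sup>2 *\<^sub>R 1"
    unfolding P_def Q_def norm_quat_squared
    by (simp_all add: quat_eq_iff quat_times_sel power2_eq_square)
  have comm: "p * (P * w + w * Q) = (P * w + w * Q) * q" for w
  proof -
    have "P * (P * w + w * Q) = (P * w + w * Q) * Q"
      by (simp add: distrib_left distrib_right mult.assoc sq) (simp add: sq flip: mult.assoc)
    then have eq: "(P + r *\<^sub>R 1) * (P * w + w * Q) = (P * w + w * Q) * (Q + r *\<^sub>R 1)" for r
      by (simp only: distrib_left[of _ Q] distrib_right[of P]) simp
    have "P + qre p *\<^sub>R 1 = p" "Q + qre p *\<^sub>R 1 = q"
      unfolding P_def Q_def using * by simp_all
    with eq[of "qre p"] show ?thesis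
      by (simp only:)
  qed
  show "similar p q"
  proof (cases "\<exists>w. P * w + w * Q \<noteq> 0")
    case True
    then show ?thesis
      using comm similarI by blast
  next
    case False
    then have *: "P * w + w * Q = 0" for w
      by simp
    \<comment> \<open>The choice w = 1 gives Q = -P. The units i, j, k then commute with
      \<open>P\<close>, which is purely imaginary and hence 0.\<close>
    have "P = 0" "Q = 0"
      using *[of 1] *[of "Quat 0 1 0 0"] *[of "Quat 0 0 1 0"] *[of "Quat 0 0 0 1"]
      unfolding P_def Q_def by (simp_all add: quat_eq_iff quat_times_sel)
    then have "p = q"
      unfolding P_def Q_def using \<open>qre p = qre q \<and> norm p = norm q\<close> by simp
    then show ?thesis
      using similarI[of 1 p q] by simp
  qed
qed

lemma similar_rcis_iff:
  "similar q (quat_of_complex (rcis (norm q) \<theta>)) \<longleftrightarrow> qre q = norm q * cos \<theta>"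
proof -
  have "norm (quat_of_complex z) = cmod z" for z
    by (simp add: norm_quat_def quat_of_complex_def cmod_def)
  then show ?thesis
    unfolding similar_iff by simp (simp add: quat_of_complex_def)
qed

lemma abs_qre_le_norm: "\<bar>qre q\<bar> \<le> norm q"
  by (rule power2_le_imp_le) (simp_all add: norm_quat_squared)

text \<open>By \<open>similar_rcis_iff\<close> the defining condition is a cosine equation. Cosine
  is injective on [0, pi], so the arccosine of \<open>qre q / norm q\<close> is its only solution
  there and the definite description denotes it.\<close>

lemma qarg:
  assumes "q \<noteq> 0"
  shows "0 \<le> qarg q" "qarg q \<le> pi" "qre q = norm q * cos (qarg q)"
proof -
  let ?P = "\<lambda>\<theta>. 0 \<le> \<theta> \<and> \<theta> \<le> pi \<and> qre q = norm q * cos \<theta>"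
  have "- 1 \<le> qre q / norm q" "qre q / norm q \<le> 1"
    using assms abs_qre_le_norm[of q] by (simp_all add: field_simps)
  then have "?P (arccos (qre q / norm q))"
    using assms arccos[of "qre q / norm q"] by simp
  moreover have "\<theta> = \<theta>'" if "?P \<theta>" "?P \<theta>'" for \<theta> \<theta>'
    using that assms by (metis cos_inj_pi mult_cancel_left norm_eq_zero)
  ultimately have "\<exists>!\<theta>. ?P \<theta>"
    by blast
  from theI'[OF this] show "0 \<le> qarg q" "qarg q \<le> pi" "qre q = norm q * cos (qarg q)"
    unfolding qarg_def similar_rcis_iff by blast+
qed

text \<open>The imaginary parts have norms |p| sin(arg p) and |q| sin(arg q). Cauchy-Schwarz for
  them bounds the real part of \<open>p * qcnj q\<close> below by |p| |q| (cos cos - sin sin), which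
  is where the sum of the two arguments comes from.\<close>

lemma norm_diff_le_qarg:
  assumes "p \<noteq> 0" "q \<noteq> 0"
  shows "(norm (p - q))\<^sup>2
    \<le> (norm p)\<^sup>2 + (norm q)\<^sup>2 - 2 * norm p * norm q * cos (qarg p + qarg q)"
proof -
  define P Q where "P = p - qre p *\<^sub>R 1" and "Q = q - qre q *\<^sub>R 1"
  have norm_im: "norm (x - qre x *\<^sub>R 1) = norm x * sin (qarg x)" if "x \<noteq> 0" for x
  proof (rule power2_eq_imp_eq)
    have "(norm (x - qre x *\<^sub>R 1))\<^sup>2 = (norm x)\<^sup>2 - (qre x)\<^sup>2"
      by (simp add: norm_quat_squared)
    also have "\<dots> = (norm x)\<^sup>2 * (1 - (cos (qarg x))\<^sup>2)"
      by (subst qarg(3)[OF that]) (simp add: power_mult_distrib algebra_simps)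
    also have "\<dots> = (norm x * sin (qarg x))\<^sup>2"
      by (simp add: power_mult_distrib sin_squared_eq)
    finally show "(norm (x - qre x *\<^sub>R 1))\<^sup>2 = (norm x * sin (qarg x))\<^sup>2" .
    show "0 \<le> norm x * sin (qarg x)"
      using qarg[OF that] by (simp add: sin_ge_zero)
  qed simp
  have "qre (p * qcnj q) = qre p * qre q + inner P Q"
    by (simp add: P_def Q_def inner_quat_def quat_times_sel)
  also have "\<dots> \<ge> qre p * qre q - norm P * norm Q"
    using Cauchy_Schwarz_ineq2[of P Q] by linarith
  also have "qre p * qre q - norm P * norm Q = norm p * norm q * cos (qarg p + qarg q)"
    unfolding P_def Q_def norm_im[OF assms(1)] norm_im[OF assms(2)]
    by (simp add: cos_add right_diff_distrib qarg(3)[OF assms(1)] qarg(3)[OF assms(2)] ac_simps)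
  finally show ?thesis
    by (simp add: norm_diff_squared)
qed

section \<open>The group SL(2,H)\<close>

lemma qmat_sel [simp]:
  "qmat a b c d $ 1 $ 1 = a" "qmat a b c d $ 1 $ 2 = b"
  "qmat a b c d $ 2 $ 1 = c" "qmat a b c d $ 2 $ 2 = d"
  by (simp_all add: qmat_def)

lemma qmat_eqI:
  assumes "A$1$1 = B$1$1" "A$1$2 = B$1$2" "A$2$1 = B$2$1" "A$2$2 = B$2$2"
  shows "A = (B :: quat^2^2)"
  using assms by (simp add: vec_eq_iff forall_2)

lemma qmat_eta: "qmat (A$1$1) (A$1$2) (A$2$1) (A$2$2) = A"
  by (rule qmat_eqI) simp_all

lemma mat_mult_sel [simp]:
  fixes A B :: "quat^2^2"
  shows "(A ** B) $ 1 $ 1 = A$1$1 * B$1$1 + A$1$2 * B$2$1"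
    and "(A ** B) $ 1 $ 2 = A$1$1 * B$1$2 + A$1$2 * B$2$2"
    and "(A ** B) $ 2 $ 1 = A$2$1 * B$1$1 + A$2$2 * B$2$1"
    and "(A ** B) $ 2 $ 2 = A$2$1 * B$1$2 + A$2$2 * B$2$2"
  by (simp_all add: matrix_matrix_mult_def sum_2)

lemma mat_one_sel [simp]:
  "(mat 1 :: quat^2^2) $ 1 $ 1 = 1" "(mat 1 :: quat^2^2) $ 1 $ 2 = 0"
  "(mat 1 :: quat^2^2) $ 2 $ 1 = 0" "(mat 1 :: quat^2^2) $ 2 $ 2 = 1"
  by (simp_all add: mat_def)

lemma qmat_mult:
  "qmat a b c d ** qmat x y z v = qmat (a * x + b * z) (a * y + b * v) (c * x + d * z) (c * y + d * v)"
  by (rule qmat_eqI) simp_all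

section \<open>The determinant and the inverse matrix\<close>

definition qdet2 :: "quat \<Rightarrow> quat \<Rightarrow> quat \<Rightarrow> quat \<Rightarrow> real" where
  "qdet2 a b c d = (norm a)\<^sup>2 * (norm d)\<^sup>2 + (norm b)\<^sup>2 * (norm c)\<^sup>2 - 2 * qre (a * qcnj c * d * qcnj b)"

lemma qdet_qmat: "qdet (qmat a b c d) = sqrt (qdet2 a b c d)"
  by (simp add: qdet_def qdet2_def)

text \<open>The right-hand side is the determinant of the Hermitian matrix B B^*, the Gram matrix of
  the rows of B. Multiplicativity thereby becomes a statement about congruences.\<close>

lemma qdet2_gram:
  "qdet2 a b c d = ((norm a)\<^sup>2 + (norm b)\<^sup>2) * ((norm c)\<^sup>2 + (norm d)\<^sup>2)
     - (norm (a * qcnj c + b * qcnj d))\<^sup>2"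
  by (simp add: qdet2_def norm_add_squared norm_mult power_mult_distrib qcnj_mult algebra_simps)

text \<open>The congruence \<open>H \<mapsto> B H B\<^sup>*\<close> of the Hermitian matrix \<open>H\<close> with diagonal \<open>p, q\<close> and
  off-diagonal entry \<open>w\<close> scales its determinant \<open>p q - |w|\<^sup>2\<close> by \<open>qdet2\<close> of \<open>B\<close>.\<close>

lemma hermitian_congruence:
  fixes p q :: real and w :: quat
  shows "((norm a)\<^sup>2 * p + (norm b)\<^sup>2 * q + 2 * qre (a * w * qcnj b))
      * ((norm c)\<^sup>2 * p + (norm d)\<^sup>2 * q + 2 * qre (c * w * qcnj d))
      - (norm ((p *\<^sub>R (a * qcnj c) + q *\<^sub>R (b * qcnj d)) + (a * w * qcnj d + b * qcnj w * qcnj c)))\<^sup>2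
      = qdet2 a b c d * (p * q - (norm w)\<^sup>2)"
proof -
  define u v where "u = qre (a * w * qcnj b)" and "v = qre (c * w * qcnj d)"
  define s t where "s = qre (a * qcnj c * d * qcnj b)" and "t = qre (a * w * qcnj d * c * w * qcnj b)"
  have e12: "qre (a * qcnj c * (d * qcnj b)) = s"
    by (simp add: s_def mult.assoc)
  have e13: "qre (a * qcnj c * (d * qcnj w * qcnj a)) = (norm a)\<^sup>2 * v"
    unfolding v_def norm_quat_squared by (simp add: quat_times_sel power2_eq_square) algebra
  have u: "qre (a * (w * qcnj b)) = u" "qre (b * (qcnj w * qcnj a)) = u"
    by (simp_all add: u_def mult.assoc) (simp add: quat_times_sel algebra_simps)
  have e24: "qre (b * qcnj d * (c * w * qcnj b)) = (norm b)\<^sup>2 * v"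
    unfolding v_def norm_quat_squared by (simp add: quat_times_sel power2_eq_square) algebra
  have e34: "qre (a * w * qcnj d * (c * w * qcnj b)) = t"
    by (simp add: t_def mult.assoc)
  \<comment> \<open>With X and Y as below, Y + conj Y is real, so the real parts of X Y and X conj Y
    add up to 2 Re X Re Y. Cyclicity of the real part identifies them with \<open>t\<close> and
    |w|^2 \<open>s\<close>.\<close>
  have key: "2 * u * v = t + (norm w)\<^sup>2 * s"
  proof -
    define X Y where "X = qcnj b * a * w" and "Y = qcnj d * c * w"
    have "u = qre X" "v = qre Y"
      unfolding u_def v_def X_def Y_def by (simp_all add: qre_mult_commute[of "qcnj _"] mult.assoc)
    moreover have "t = qre (X * Y)"
      unfolding t_def X_def Y_def using qre_mult_commute[of "qcnj b"] by (simp add: mult.assoc)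
    moreover have "(norm w)\<^sup>2 * s = qre (X * qcnj Y)"
      unfolding s_def X_def Y_def
      using qre_mult_commute[of "qcnj b"] by (simp add: qcnj_mult mult.assoc)
    moreover have "2 * qre X * qre Y = qre (X * Y) + qre (X * qcnj Y)"
      by (simp add: quat_times_sel)
    ultimately show ?thesis
      by simp
  qed
  have n1: "(norm (p *\<^sub>R (a * qcnj c) + q *\<^sub>R (b * qcnj d)))\<^sup>2
      = p\<^sup>2 * (norm a)\<^sup>2 * (norm c)\<^sup>2 + q\<^sup>2 * (norm b)\<^sup>2 * (norm d)\<^sup>2 + 2 * p * q * s"
    unfolding norm_add_squared by (simp add: norm_mult power_mult_distrib qcnj_mult qcnj_scaleR e12)
  have n2: "(norm (a * w * qcnj d + b * qcnj w * qcnj c))\<^sup>2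
      = (norm w)\<^sup>2 * ((norm a)\<^sup>2 * (norm d)\<^sup>2 + (norm b)\<^sup>2 * (norm c)\<^sup>2) + 2 * t"
    unfolding norm_add_squared
    using e34 by (simp add: norm_mult power_mult_distrib qcnj_mult mult.assoc algebra_simps)
  have n12: "qre ((p *\<^sub>R (a * qcnj c) + q *\<^sub>R (b * qcnj d)) * qcnj (a * w * qcnj d + b * qcnj w * qcnj c))
      = p * (norm a)\<^sup>2 * v + p * (norm c)\<^sup>2 * u + q * (norm d)\<^sup>2 * u + q * (norm b)\<^sup>2 * v"
    using e13 e24
    by (simp add: u qcnj_add qcnj_mult distrib_left distrib_right mult.assoc)
  show ?thesis
    unfolding norm_add_squared[of "p *\<^sub>R (a * qcnj c) + q *\<^sub>R (b * qcnj d)"] n1 n2 n12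
      qdet2_def u_def[symmetric] v_def[symmetric] s_def[symmetric]
    using key by (simp add: algebra_simps power2_eq_square)
qed

lemma qdet2_mult:
  "qdet2 (a * x + b * z) (a * y + b * v) (c * x + d * z) (c * y + d * v)
    = qdet2 a b c d * qdet2 x y z v"
proof -
  define p q w where "p = (norm x)\<^sup>2 + (norm y)\<^sup>2" and "q = (norm z)\<^sup>2 + (norm v)\<^sup>2"
    and "w = x * qcnj z + y * qcnj v"
  have row: "(norm (e * x + f * z))\<^sup>2 + (norm (e * y + f * v))\<^sup>2
      = (norm e)\<^sup>2 * p + (norm f)\<^sup>2 * q + 2 * qre (e * w * qcnj f)" for e f
    unfolding norm_add_squared p_def q_def w_def
    by (simp add: norm_mult power_mult_distrib qcnj_mult mult.assoc distrib_left distrib_right)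
  have cross: "(a * x + b * z) * qcnj (c * x + d * z) + (a * y + b * v) * qcnj (c * y + d * v)
      = (p *\<^sub>R (a * qcnj c) + q *\<^sub>R (b * qcnj d)) + (a * w * qcnj d + b * qcnj w * qcnj c)"
  proof -
    have "x * (qcnj x * k) = (norm x)\<^sup>2 *\<^sub>R k" for x k :: quat
      by simp
    then show ?thesis
      unfolding p_def q_def w_def
      by (simp add: qcnj_mult qcnj_add mult.assoc distrib_left distrib_right scaleR_left_distrib)
  qed
  show ?thesis
    unfolding qdet2_gram[of "a * x + b * z"] row cross hermitian_congruence
    by (simp add: qdet2_gram[of x y] p_def q_def w_def)
qed

lemma qdet_mult: "qdet (A ** B) = qdet A * qdet B"
proof -
  have "qdet (qmat a b c d ** qmat x y z v) = qdet (qmat a b c d) * qdet (qmat x y z v)" for a b c d x y z v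
    by (simp add: qmat_mult qdet_qmat qdet2_mult real_sqrt_mult)
  then show ?thesis
    by (metis qmat_eta)
qed

text \<open>A noncommutative adjugate: its products with \<open>A\<close> are the squared
  determinant times the identity. For determinant 1 it is the inverse, given by polynomials in the
  real components and without case distinctions on vanishing entries.\<close>

definition qadj :: "quat^2^2 \<Rightarrow> quat^2^2" where
  "qadj A = (let a = A$1$1; b = A$1$2; c = A$2$1; d = A$2$2 in
    qmat ((norm d)\<^sup>2 *\<^sub>R qcnj a - qcnj c * d * qcnj b) ((norm b)\<^sup>2 *\<^sub>R qcnj c - qcnj a * b * qcnj d)
         ((norm c)\<^sup>2 *\<^sub>R qcnj b - qcnj d * c * qcnj a) ((norm a)\<^sup>2 *\<^sub>R qcnj d - qcnj b * a * qcnj c))"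

lemma qdet_eq_1_iff: "qdet (qmat a b c d) = 1 \<longleftrightarrow> qdet2 a b c d = 1"
  by (simp add: qdet_qmat)

lemma qadj_qmat:
  "qadj (qmat a b c d) =
    qmat ((norm d)\<^sup>2 *\<^sub>R qcnj a - qcnj c * d * qcnj b) ((norm b)\<^sup>2 *\<^sub>R qcnj c - qcnj a * b * qcnj d)
         ((norm c)\<^sup>2 *\<^sub>R qcnj b - qcnj d * c * qcnj a) ((norm a)\<^sup>2 *\<^sub>R qcnj d - qcnj b * a * qcnj c)"
  by (simp add: qadj_def)

text \<open>A quaternion and its conjugate add up to twice the real part. The diagonal entries of
  the products with \<open>qadj\<close> have this shape, \<open>x\<close> being a cyclic
  rearrangement of the fourfold product in \<open>qdet2\<close>.\<close>

lemma qdet2_diag: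
  assumes "qre x = qre (a * qcnj c * d * qcnj b)"
  shows "((norm a)\<^sup>2 * (norm d)\<^sup>2) *\<^sub>R 1 - x + (((norm b)\<^sup>2 * (norm c)\<^sup>2) *\<^sub>R 1 - qcnj x)
    = qdet2 a b c d *\<^sub>R 1"
  using assms by (simp add: quat_eq_iff qdet2_def)

lemma qadj_mult_qmat:
  "qadj (qmat a b c d) ** qmat a b c d = qmat (qdet2 a b c d *\<^sub>R 1) 0 0 (qdet2 a b c d *\<^sub>R 1)"
  and qmat_mult_qadj:
  "qmat a b c d ** qadj (qmat a b c d) = qmat (qdet2 a b c d *\<^sub>R 1) 0 0 (qdet2 a b c d *\<^sub>R 1)"
proof -
  have cyc: "qre (qcnj c * d * qcnj b * a) = qre (a * qcnj c * d * qcnj b)"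
    "qre (qcnj b * a * qcnj c * d) = qre (a * qcnj c * d * qcnj b)"
    "qre (d * qcnj b * a * qcnj c) = qre (a * qcnj c * d * qcnj b)"
    by (simp_all add: quat_times_sel algebra_simps)
  show "qadj (qmat a b c d) ** qmat a b c d = qmat (qdet2 a b c d *\<^sub>R 1) 0 0 (qdet2 a b c d *\<^sub>R 1)"
    unfolding qadj_qmat qmat_mult using qdet2_diag[OF cyc(1)] qdet2_diag[OF cyc(2)]
    by (intro qmat_eqI)
      (simp_all add: left_diff_distrib mult.assoc qcnj_mult mult.commute add.commute)
  show "qmat a b c d ** qadj (qmat a b c d) = qmat (qdet2 a b c d *\<^sub>R 1) 0 0 (qdet2 a b c d *\<^sub>R 1)"
    unfolding qadj_qmat qmat_mult using qdet2_diag[of "a * qcnj c * d * qcnj b" a c d b] qdet2_diag[OF cyc(3)]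
    by (intro qmat_eqI)
      (simp_all add: right_diff_distrib mult.assoc qcnj_mult mult.commute add.commute)
qed

text \<open>Expanding the squared norm and rotating the mixed term cyclically lets |d|^2 factor out,
  and the remaining factor is \<open>qdet2 a b c d\<close>.\<close>

lemma norm_qadj_entry:
  assumes "qdet2 a b c d = 1"
  shows "norm ((norm d)\<^sup>2 *\<^sub>R qcnj a - qcnj c * d * qcnj b) = norm d"
proof (rule power2_eq_imp_eq)
  have "(norm ((norm d)\<^sup>2 *\<^sub>R qcnj a - qcnj c * d * qcnj b))\<^sup>2
      = ((norm d)\<^sup>2 * norm a)\<^sup>2 + (norm c * norm d * norm b)\<^sup>2
        - 2 * ((norm d)\<^sup>2 * qre (qcnj a * (b * (qcnj d * c))))"
    unfolding norm_diff_squared by (simp add: norm_mult qcnj_mult mult.assoc)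
  also have "qre (qcnj a * (b * (qcnj d * c))) = qre (a * qcnj c * d * qcnj b)"
    by (simp add: quat_times_sel algebra_simps)
  also have "((norm d)\<^sup>2 * norm a)\<^sup>2 + (norm c * norm d * norm b)\<^sup>2
      - 2 * ((norm d)\<^sup>2 * qre (a * qcnj c * d * qcnj b)) = (norm d)\<^sup>2 * qdet2 a b c d"
    unfolding qdet2_def power_mult_distrib
    by (simp only: power2_eq_square right_diff_distrib distrib_left) (simp only: ac_simps)
  finally show "(norm ((norm d)\<^sup>2 *\<^sub>R qcnj a - qcnj c * d * qcnj b))\<^sup>2 = (norm d)\<^sup>2"
    using assms by simp
qed simp_all

lemma norm_qadj:
  assumes "qdet A = 1"
  shows "norm (qadj A $ 1 $ 1) = norm (A $ 2 $ 2)" "norm (qadj A $ 1 $ 2) = norm (A $ 1 $ 2)"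
    and "norm (qadj A $ 2 $ 1) = norm (A $ 2 $ 1)" "norm (qadj A $ 2 $ 2) = norm (A $ 1 $ 1)"
proof -
  define a b c d where defs: "a = A $ 1 $ 1" "b = A $ 1 $ 2" "c = A $ 2 $ 1" "d = A $ 2 $ 2"
  have A: "A = qmat a b c d"
    by (simp add: defs qmat_eta)
  have det: "qdet2 a b c d = 1"
    using assms unfolding A qdet_eq_1_iff .
  \<comment> \<open>Exchanging the rows, the columns or both leaves \<open>qdet2\<close> unchanged,
    so \<open>norm_qadj_entry\<close> covers all four entries.\<close>
  have "qre (c * qcnj a * b * qcnj d) = qre (a * qcnj c * d * qcnj b)"
    "qre (b * qcnj d * c * qcnj a) = qre (a * qcnj c * d * qcnj b)"
    "qre (d * qcnj b * a * qcnj c) = qre (a * qcnj c * d * qcnj b)"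
    by (simp_all add: quat_times_sel algebra_simps)
  then have "qdet2 c d a b = 1" "qdet2 b a d c = 1" "qdet2 d c b a = 1"
    using det by (simp_all add: qdet2_def ac_simps)
  then show "norm (qadj A $ 1 $ 1) = norm (A $ 2 $ 2)" "norm (qadj A $ 1 $ 2) = norm (A $ 1 $ 2)"
    "norm (qadj A $ 2 $ 1) = norm (A $ 2 $ 1)" "norm (qadj A $ 2 $ 2) = norm (A $ 1 $ 1)"
    using det by (simp_all add: A qadj_qmat norm_qadj_entry)
qed

lemma qadj_mult:
  assumes "qdet A = 1"
  shows "qadj A ** A = mat 1" "A ** qadj A = mat 1"
proof -
  define a b c d where defs: "a = A $ 1 $ 1" "b = A $ 1 $ 2" "c = A $ 2 $ 1" "d = A $ 2 $ 2"
  have A: "A = qmat a b c d"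
    by (simp add: defs qmat_eta)
  have "qdet2 a b c d = 1"
    using assms unfolding A qdet_eq_1_iff .
  then show "qadj A ** A = mat 1" "A ** qadj A = mat 1"
    unfolding A qadj_mult_qmat qmat_mult_qadj by (simp_all add: qmat_eqI)
qed

section \<open>The group structure\<close>

lemma SL2H_simps [simp]:
  "A \<in> carrier SL2H \<longleftrightarrow> qdet A = 1" "A \<otimes>\<^bsub>SL2H\<^esub> B = A ** B" "\<one>\<^bsub>SL2H\<^esub> = mat 1"
  by (simp_all add: SL2H_def)

lemma qdet_one: "qdet (mat 1) = 1"
  by (simp add: qdet_def)

lemma qdet_qadj: "qdet A = 1 \<Longrightarrow> qdet (qadj A) = 1"
  using qdet_mult[of "qadj A" A] by (simp add: qadj_mult qdet_one)

lemma group_SL2H: "group SL2H"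
proof (rule groupI)
  fix A
  assume "A \<in> carrier SL2H"
  then show "\<exists>B\<in>carrier SL2H. B \<otimes>\<^bsub>SL2H\<^esub> A = \<one>\<^bsub>SL2H\<^esub>"
    by (intro bexI[of _ "qadj A"]) (simp_all add: qadj_mult qdet_qadj)
qed (simp_all add: qdet_mult qdet_one matrix_mul_assoc)

lemma inv_SL2H: "qdet A = 1 \<Longrightarrow> inv\<^bsub>SL2H\<^esub> A = qadj A"
  using group.inv_equality[OF group_SL2H, of "qadj A" A] by (simp add: qadj_mult qdet_qadj)

lemma subgroup_SL2H:
  assumes "subgroup G SL2H"
  shows "A \<in> G \<Longrightarrow> qdet A = 1" "mat 1 \<in> G" "A \<in> G \<Longrightarrow> B \<in> G \<Longrightarrow> A ** B \<in> G" "A \<in> G \<Longrightarrow> qadj A \<in> G"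
  using subgroup.mem_carrier[OF assms] subgroup.one_closed[OF assms] subgroup.m_closed[OF assms]
    subgroup.m_inv_closed[OF assms] inv_SL2H by (simp, simp, simp, fastforce)

section \<open>Limits of matrices and discrete subgroups\<close>

lemma mat2_tendstoI:
  fixes f :: "'a \<Rightarrow> 'b::topological_space^2^2"
  assumes "((\<lambda>x. f x $ 1 $ 1) \<longlongrightarrow> L $ 1 $ 1) F" "((\<lambda>x. f x $ 1 $ 2) \<longlongrightarrow> L $ 1 $ 2) F"
    and "((\<lambda>x. f x $ 2 $ 1) \<longlongrightarrow> L $ 2 $ 1) F" "((\<lambda>x. f x $ 2 $ 2) \<longlongrightarrow> L $ 2 $ 2) F"
  shows "(f \<longlongrightarrow> L) F"
proof (intro vec_tendstoI)
  fix i j :: 2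
  show "((\<lambda>x. f x $ i $ j) \<longlongrightarrow> L $ i $ j) F"
    using assms exhaust_2[of i] exhaust_2[of j] by auto
qed

lemma qadj_mult_tendsto:
  fixes f g :: "'a \<Rightarrow> quat^2^2"
  assumes "(f \<longlongrightarrow> L) F" "(g \<longlongrightarrow> M) F"
  shows "((\<lambda>x. qadj (f x) ** g x) \<longlongrightarrow> qadj L ** M) F"
  by (rule mat2_tendstoI; simp add: qadj_def Let_def; intro tendsto_intros assms)

lemma norm_vec2_le:
  fixes v :: "'b::real_normed_vector^2"
  shows "norm v \<le> norm (v $ 1) + norm (v $ 2)"
  unfolding norm_vec_def using L2_set_le_sum[of UNIV "\<lambda>i. norm (v $ i)"] by (simp add: sum_2)

text \<open>Boundedness yields a convergent subsequence, and continuity of \<open>qadj\<close> makes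
  its limit invertible. Quotients of consecutive terms then tend to the identity, which is isolated
  in \<open>G\<close>, so they eventually equal it.\<close>

lemma discrete_subgroup_subsequence:
  assumes G: "subgroup G SL2H" "discrete G"
    and U: "\<And>n. U n \<in> G" "\<And>n :: nat. norm (U n) \<le> C"
  obtains r L where "strict_mono (r :: nat \<Rightarrow> nat)" "\<forall>\<^sub>F n in sequentially. U (r n) = L"
proof -
  note sub = subgroup_SL2H[OF G(1)]
  have "bounded (range U)"
    using U(2) by (auto simp: bounded_iff)
  then obtain r L where r: "strict_mono r" and L: "(\<lambda>n. U (r n)) \<longlonglongrightarrow> L"
    using bounded_imp_convergent_subsequence[of U] by (auto simp: o_def)
  have "(\<lambda>n. qadj (U (r n)) ** U (r n)) \<longlonglongrightarrow> qadj L ** L"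
    by (rule qadj_mult_tendsto[OF L L])
  then have "(\<lambda>n. mat 1 :: quat^2^2) \<longlonglongrightarrow> qadj L ** L"
    by (simp add: qadj_mult sub(1)[OF U(1)])
  then have "qadj L ** L = mat 1"
    using LIMSEQ_unique tendsto_const by blast
  then have lim: "(\<lambda>n. qadj (U (r n)) ** U (r (Suc n))) \<longlonglongrightarrow> mat 1"
    using qadj_mult_tendsto[OF L LIMSEQ_Suc[OF L]] by simp
  obtain e where e: "e > 0" "\<And>A. A \<in> G \<Longrightarrow> dist (mat 1) A < e \<Longrightarrow> A = mat 1"
    using discreteD[OF G(2) sub(2)] unfolding isolated_in_dist_Ex_iff by blast
  have "\<forall>\<^sub>F n in sequentially. U (r (Suc n)) = U (r n)"
    using tendstoD[OF lim e(1)]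
  proof eventually_elim
    case (elim n)
    then have "qadj (U (r n)) ** U (r (Suc n)) = mat 1"
      by (intro e(2)) (simp_all add: sub U(1) dist_commute)
    then have "U (r n) ** (qadj (U (r n)) ** U (r (Suc n))) = U (r n)"
      by simp
    then show ?case
      by (simp add: matrix_mul_assoc qadj_mult sub(1)[OF U(1)])
  qed
  then obtain N where N: "\<And>n. n \<ge> N \<Longrightarrow> U (r (Suc n)) = U (r n)"
    unfolding eventually_sequentially by blast
  have "U (r n) = U (r N)" if "n \<ge> N" for n
    using that by (induction n rule: dec_induct) (simp_all add: N)
  then show ?thesis
    using that[OF r, of "U (r N)"] unfolding eventually_sequentially by blast
qed

section \<open>Monomial matrices and elementary subgroups\<close>

definition monomial_mat :: "quat^2^2 \<Rightarrow> bool" where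
  "monomial_mat A \<longleftrightarrow> A $ 1 $ 2 = 0 \<and> A $ 2 $ 1 = 0 \<or> A $ 1 $ 1 = 0 \<and> A $ 2 $ 2 = 0"

lemma monomial_mat_qadj:
  assumes "monomial_mat A"
  shows "monomial_mat (qadj A)"
  using assms unfolding monomial_mat_def by (elim disjE) (simp_all add: qadj_def Let_def)

lemma monomial_mat_mult:
  assumes "monomial_mat A" "monomial_mat B"
  shows "monomial_mat (A ** B)"
  using assms unfolding monomial_mat_def by (elim disjE) simp_all

text \<open>Monomial matrices are closed under products and inverses and preserve the pair {0,
  infinity}, so the orbit of infinity has at most two points.\<close>

lemma elementary_generate_monomial:
  assumes "H \<subseteq> carrier SL2H" "\<And>A. A \<in> H \<Longrightarrow> monomial_mat A"
  shows "elementary (generate SL2H H)"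
proof -
  have mon: "monomial_mat A" if "A \<in> generate SL2H H" for A
    using that
  proof induction
    case one
    then show ?case
      by (simp add: monomial_mat_def)
  next
    case (incl h)
    then show ?case
      using assms by simp
  next
    case (inv h)
    then have "inv\<^bsub>SL2H\<^esub> h = qadj h" "monomial_mat h"
      using assms inv_SL2H[of h] by (simp_all add: subset_iff)
    then show ?case
      using monomial_mat_qadj by simp
  next
    case (eng g h)
    then show ?case
      using monomial_mat_mult by simp
  qed
  have "moebius A None \<in> {None, Some 0}" if "monomial_mat A" for A
    using that by (auto simp: monomial_mat_def moebius_def Let_def)
  then have "(\<lambda>A. moebius A None) ` generate SL2H H \<subseteq> {None, Some 0}"
    using mon by (intro image_subsetI) simp
  then have "finite ((\<lambda>A. moebius A None) ` generate SL2H H)"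
    by (rule finite_subset) simp
  then show ?thesis
    unfolding elementary_def by (intro disjI2 exI)
qed

section \<open>The iteration\<close>

lemma qarg_conjugate:
  assumes "u \<noteq> 0"
  shows "qarg (u * q * inverse u) = qarg q"
  unfolding qarg_def similar_rcis_iff by (simp add: assms norm_conjugate qre_conjugate)

lemma norm_diff_conjugates_le:
  assumes "p \<noteq> 0" "q \<noteq> 0" "u \<noteq> 0" "v \<noteq> 0"
  shows "(norm (v * q * inverse v - u * p * inverse u))\<^sup>2
    \<le> (norm p)\<^sup>2 + (norm q)\<^sup>2 - 2 * norm p * norm q * cos (qarg p + qarg q)"
  using norm_diff_le_qarg[of "u * p * inverse u" "v * q * inverse v"] assms
  by (simp add: norm_conjugate qarg_conjugate norm_minus_commute)

lemma conjugates_eq_imp_similar: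
  assumes "u \<noteq> 0" "v \<noteq> 0" "v * q * inverse v = u * p * inverse u"
  shows "similar p q"
  using assms by (metis similar_iff norm_conjugate qre_conjugate)

text \<open>The ratios eventually stay below some s < 1, so the series converges by the ratio test
  and its terms vanish in the limit.\<close>

lemma ratio_tendsto_zero:
  fixes x k :: "nat \<Rightarrow> real"
  assumes "\<And>n. 0 \<le> x n" "\<And>n. x (Suc n) \<le> k n * x n" "k \<longlonglongrightarrow> l" "l < 1"
  shows "x \<longlonglongrightarrow> 0"
proof -
  obtain s where s: "l < s" "s < 1"
    using assms(4) dense by blast
  obtain N where N: "\<And>n. n \<ge> N \<Longrightarrow> k n < s"
    using order_tendstoD(2)[OF assms(3) s(1)] unfolding eventually_sequentially by blast
  have "summable x"
  proof (rule summable_ratio_test[OF s(2)])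
    fix n
    assume "n \<ge> N"
    then have "k n * x n \<le> s * x n"
      using N assms(1) by (intro mult_right_mono) (auto intro: less_imp_le)
    then show "norm (x (Suc n)) \<le> s * norm (x n)"
      using assms(1,2)[of n] assms(1)[of "Suc n"] by simp
  qed
  then show ?thesis
    by (rule summable_LIMSEQ_zero)
qed

text \<open>An off-diagonal entry of \<open>A T A\<^sup>-\<^sup>1\<close>, where \<open>y', w'\<close> come from the inverse matrix.\<close>

lemma offdiag_entry:
  fixes x y' z w' p q :: quat
  assumes "x * y' + z * w' = 0" "norm w' = norm x" "norm y' = norm z"
  shows "norm (x * p * y' + z * q * w')
    = (if x = 0 \<or> z = 0 then 0 else norm (z * q * inverse z - x * p * inverse x) * norm x * norm z)"
proof (cases "x = 0 \<or> z = 0")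
  case True
  then have "x = 0 \<and> w' = 0 \<or> z = 0 \<and> y' = 0"
    using assms(2,3) by auto
  then show ?thesis
    by auto
next
  case False
  have y': "x * y' = - (z * w')"
    using assms(1) by (simp add: eq_neg_iff_add_eq_0)
  \<comment> \<open>Inserting \<open>inverse x * x\<close> and using x y' = - z w' gives both
    summands the common right factor z w', whose norm is |z| |x|.\<close>
  have "x * p * y' = x * p * inverse x * (x * y')"
    using False by (simp add: mult.assoc) (simp add: mult.assoc[symmetric])
  also have "\<dots> = - (x * p * inverse x * z * w')"
    by (simp add: y' mult.assoc)
  finally have "x * p * y' + z * q * w' = (z * q * inverse z - x * p * inverse x) * z * w'"
    using False by (simp add: left_diff_distrib mult.assoc)
  then show ?thesis
    using False by (simp add: norm_mult assms(2))
qed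

text \<open>\<open>K\<close> enters only as a bound for squared distances between conjugates of
  \<open>mu\<close> and \<open>lam\<close>. The condition on the real trace serves to rule out
  antidiagonal iterates after the start.\<close>

locale conjugation_iteration =
  fixes lam mu :: quat and K :: real and A :: "nat \<Rightarrow> quat^2^2"
  assumes norm_lam_mu: "norm lam * norm mu = 1"
    and conj_le: "\<And>u v. u \<noteq> 0 \<Longrightarrow> v \<noteq> 0 \<Longrightarrow>
      (norm (v * mu * inverse v - u * lam * inverse u))\<^sup>2 \<le> K"
    and not_similar: "\<not> similar lam mu"
    and trace_nonzero: "qre lam + qre mu \<noteq> 0"
    and det_0: "qdet (A 0) = 1"
    and A_Suc: "\<And>n. A (Suc n) = A n ** qmat lam 0 0 mu ** qadj (A n)"
    and small: "K * (1 + norm (A 0 $ 1 $ 2) * norm (A 0 $ 2 $ 1)) < 1"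
begin

section \<open>Entries of the iterates and their estimates\<close>

lemma nonzero: "lam \<noteq> 0" "mu \<noteq> 0"
  using norm_lam_mu by auto

lemma det_diag: "qdet (qmat lam 0 0 mu) = 1"
  using norm_lam_mu by (simp add: qdet_def flip: power_mult_distrib)

lemma det: "qdet (A n) = 1"
  by (induction n) (simp_all add: det_0 A_Suc qdet_mult det_diag qdet_qadj)

abbreviation "a n \<equiv> A n $ 1 $ 1"
abbreviation "b n \<equiv> A n $ 1 $ 2"
abbreviation "c n \<equiv> A n $ 2 $ 1"
abbreviation "d n \<equiv> A n $ 2 $ 2"

definition "x n = norm (b n) * norm (c n)"

lemma x_nonneg: "0 \<le> x n"
  by (simp add: x_def)

lemma inverse_entries:
  "a n * qadj (A n) $ 1 $ 1 + b n * qadj (A n) $ 2 $ 1 = 1"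
  "a n * qadj (A n) $ 1 $ 2 + b n * qadj (A n) $ 2 $ 2 = 0"
  "c n * qadj (A n) $ 1 $ 1 + d n * qadj (A n) $ 2 $ 1 = 0"
  "qadj (A n) $ 1 $ 1 * a n + qadj (A n) $ 1 $ 2 * c n = 1"
  "qadj (A n) $ 2 $ 1 * b n + qadj (A n) $ 2 $ 2 * d n = 1"
  using arg_cong[OF qadj_mult(1)[OF det[of n]], of "\<lambda>B. B $ 1 $ 1"]
    arg_cong[OF qadj_mult(1)[OF det[of n]], of "\<lambda>B. B $ 2 $ 2"]
    arg_cong[OF qadj_mult(2)[OF det[of n]], of "\<lambda>B. B $ 1 $ 1"]
    arg_cong[OF qadj_mult(2)[OF det[of n]], of "\<lambda>B. B $ 1 $ 2"]
    arg_cong[OF qadj_mult(2)[OF det[of n]], of "\<lambda>B. B $ 2 $ 1"]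
  by simp_all

lemma entries_Suc:
  "a (Suc n) = a n * lam * qadj (A n) $ 1 $ 1 + b n * mu * qadj (A n) $ 2 $ 1"
  "b (Suc n) = a n * lam * qadj (A n) $ 1 $ 2 + b n * mu * qadj (A n) $ 2 $ 2"
  "c (Suc n) = c n * lam * qadj (A n) $ 1 $ 1 + d n * mu * qadj (A n) $ 2 $ 1"
  "d (Suc n) = c n * lam * qadj (A n) $ 1 $ 2 + d n * mu * qadj (A n) $ 2 $ 2"
  by (simp_all add: A_Suc)

lemma norm_b_Suc: "norm (b (Suc n)) = (if a n = 0 \<or> b n = 0 then 0
    else norm (b n * mu * inverse (b n) - a n * lam * inverse (a n)) * norm (a n) * norm (b n))"
  unfolding entries_Suc
  by (rule offdiag_entry) (simp_all add: inverse_entries norm_qadj det)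

lemma norm_c_Suc: "norm (c (Suc n)) = (if c n = 0 \<or> d n = 0 then 0
    else norm (d n * mu * inverse (d n) - c n * lam * inverse (c n)) * norm (d n) * norm (c n))"
  unfolding entries_Suc
  by (subst offdiag_entry) (simp_all add: inverse_entries norm_qadj det)

lemma K_nonneg: "0 \<le> K"
  using order_trans[OF zero_le_power2 conj_le[of 1 1]] by simp

lemma norm_b_Suc_le: "norm (b (Suc n)) \<le> sqrt K * norm (a n) * norm (b n)"
  unfolding norm_b_Suc using K_nonneg
  by (auto intro!: mult_right_mono real_le_rsqrt conj_le)

lemma norm_c_Suc_le: "norm (c (Suc n)) \<le> sqrt K * norm (d n) * norm (c n)"
  unfolding norm_c_Suc using K_nonneg
  by (auto intro!: mult_right_mono real_le_rsqrt conj_le)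

text \<open>The first row of \<open>A n\<close> times the first column of its inverse is 1, and that
  column has entries of norms |d| and |c|; the triangle inequality does the rest.\<close>

lemma norm_ad_le: "norm (a n) * norm (d n) \<le> 1 + x n"
proof -
  have "norm (a n) * norm (d n) = norm (a n * qadj (A n) $ 1 $ 1)"
    by (simp add: norm_mult norm_qadj det)
  also have "a n * qadj (A n) $ 1 $ 1 = 1 - b n * qadj (A n) $ 2 $ 1"
    using inverse_entries(1)[of n] by (simp add: algebra_simps)
  also have "norm \<dots> \<le> norm (1 :: quat) + norm (b n * qadj (A n) $ 2 $ 1)"
    by (rule norm_triangle_ineq4)
  also have "\<dots> = 1 + x n"
    by (simp add: norm_mult norm_qadj det x_def)
  finally show ?thesis .
qed

text \<open>The two summands of the new entry have norms |lam| |a d| and |mu| |b c|. The bound tends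
  to |lam| once \<open>x\<close> tends to 0.\<close>

lemma norm_a_Suc_le: "norm (a (Suc n)) \<le> norm lam * (1 + x n) + norm mu * x n"
proof -
  have "norm (a (Suc n)) \<le> norm lam * (norm (a n) * norm (d n)) + norm mu * x n"
    unfolding entries_Suc
    by (rule norm_triangle_le) (simp add: norm_mult norm_qadj det x_def)
  also have "\<dots> \<le> norm lam * (1 + x n) + norm mu * x n"
    by (intro add_right_mono mult_left_mono norm_ad_le) simp
  finally show ?thesis .
qed

lemma norm_d_Suc_le: "norm (d (Suc n)) \<le> norm lam * x n + norm mu * (1 + x n)"
proof -
  have "norm (d (Suc n)) \<le> norm lam * x n + norm mu * (norm (a n) * norm (d n))"
    unfolding entries_Suc
    by (rule norm_triangle_le) (simp add: norm_mult norm_qadj det x_def)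
  also have "\<dots> \<le> norm lam * x n + norm mu * (1 + x n)"
    by (intro add_left_mono mult_left_mono norm_ad_le) simp
  finally show ?thesis .
qed

text \<open>Multiplying the bounds for b and c combines the diagonal entries into |a d|, which
  \<open>norm_ad_le\<close> controls even if one factor alone is large.\<close>

lemma x_Suc_le: "x (Suc n) \<le> K * (1 + x n) * x n"
proof -
  have "x (Suc n) \<le> (sqrt K * norm (a n) * norm (b n)) * (sqrt K * norm (d n) * norm (c n))"
    unfolding x_def using K_nonneg
    by (intro mult_mono norm_b_Suc_le norm_c_Suc_le mult_nonneg_nonneg) auto
  also have "\<dots> = (sqrt K * sqrt K) * (norm (a n) * norm (d n)) * x n"
    unfolding x_def by (simp only: ac_simps)
  also have "sqrt K * sqrt K = K"
    using K_nonneg by simp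
  also have "K * (norm (a n) * norm (d n)) * x n \<le> K * (1 + x n) * x n"
    by (intro mult_left_mono mult_right_mono norm_ad_le x_nonneg K_nonneg)
  finally show ?thesis .
qed

section \<open>Decay of the off-diagonal entries\<close>

lemma small_x: "K * (1 + x 0) < 1"
  using small by (simp add: x_def)

lemma K_less_1: "K < 1"
proof -
  have "K * 1 \<le> K * (1 + x 0)"
    using K_nonneg x_nonneg by (intro mult_left_mono) auto
  then show ?thesis
    using small_x by simp
qed

text \<open>As long as \<open>x n\<close> stays below \<open>x 0\<close>, the factor
  \<open>K * (1 + x n)\<close> is below 1, so the next value is no larger and the bound reproduces
  itself.\<close>

lemma x_le: "x n \<le> x 0"
proof (induction n)
  case (Suc n)
  have "x (Suc n) \<le> K * (1 + x 0) * x n"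
    using x_Suc_le[of n] Suc K_nonneg x_nonneg[of n]
    by (meson add_left_mono mult_left_mono mult_right_mono order_trans)
  also have "\<dots> \<le> 1 * x n"
    using small_x x_nonneg by (intro mult_right_mono) auto
  finally show ?case
    using Suc by simp
qed simp

lemma x_tendsto: "x \<longlonglongrightarrow> 0"
proof (rule ratio_tendsto_zero[OF x_nonneg _ tendsto_const small_x])
  fix n
  show "x (Suc n) \<le> K * (1 + x 0) * x n"
    using x_Suc_le[of n] x_le[of n] K_nonneg x_nonneg[of n]
    by (meson add_left_mono mult_left_mono mult_right_mono order_trans)
qed

text \<open>As |a n| is asymptotically at most |lam|, the factor |mu| in the weight cancels it: the
  ratio bounds tend to sqrt K < 1. The same weight arises from conjugation by powers of T.\<close>

lemma b_tendsto: "(\<lambda>n. norm mu ^ n * norm (b n)) \<longlonglongrightarrow> 0"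
\<comment> \<open>The sequence is shifted by one because the bound on |a| concerns iterates of index
  at least 1.\<close>
proof (rule LIMSEQ_imp_Suc, rule ratio_tendsto_zero)
  fix n
  let ?k = "sqrt K * (norm lam * (1 + x n) + norm mu * x n) * norm mu"
  have "norm (b (Suc (Suc n))) \<le> sqrt K * norm (a (Suc n)) * norm (b (Suc n))"
    by (rule norm_b_Suc_le)
  also have "\<dots> \<le> sqrt K * (norm lam * (1 + x n) + norm mu * x n) * norm (b (Suc n))"
    by (intro mult_left_mono mult_right_mono norm_a_Suc_le) (simp_all add: K_nonneg)
  finally have "norm mu ^ Suc (Suc n) * norm (b (Suc (Suc n)))
      \<le> norm mu ^ Suc (Suc n) * (sqrt K * (norm lam * (1 + x n) + norm mu * x n) * norm (b (Suc n)))"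
    by (intro mult_left_mono) simp_all
  then show "norm mu ^ Suc (Suc n) * norm (b (Suc (Suc n))) \<le> ?k * (norm mu ^ Suc n * norm (b (Suc n)))"
    by (simp add: ac_simps)
next
  have "(\<lambda>n. sqrt K * (norm lam * (1 + x n) + norm mu * x n) * norm mu)
      \<longlonglongrightarrow> sqrt K * (norm lam * (1 + 0) + norm mu * 0) * norm mu"
    by (intro tendsto_intros x_tendsto)
  then show "(\<lambda>n. sqrt K * (norm lam * (1 + x n) + norm mu * x n) * norm mu) \<longlonglongrightarrow> sqrt K"
    by (simp add: norm_lam_mu mult.assoc)
qed (simp_all add: K_less_1)

text \<open>The mirror image of \<open>b_tendsto\<close>: now |d n| is asymptotically at most |mu|,
  which the weight |lam| cancels.\<close>

lemma c_tendsto: "(\<lambda>n. norm lam ^ n * norm (c n)) \<longlonglongrightarrow> 0"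
proof (rule LIMSEQ_imp_Suc, rule ratio_tendsto_zero)
  fix n
  let ?k = "sqrt K * (norm lam * x n + norm mu * (1 + x n)) * norm lam"
  have "norm (c (Suc (Suc n))) \<le> sqrt K * norm (d (Suc n)) * norm (c (Suc n))"
    by (rule norm_c_Suc_le)
  also have "\<dots> \<le> sqrt K * (norm lam * x n + norm mu * (1 + x n)) * norm (c (Suc n))"
    by (intro mult_left_mono mult_right_mono norm_d_Suc_le) (simp_all add: K_nonneg)
  finally have "norm lam ^ Suc (Suc n) * norm (c (Suc (Suc n)))
      \<le> norm lam ^ Suc (Suc n) * (sqrt K * (norm lam * x n + norm mu * (1 + x n)) * norm (c (Suc n)))"
    by (intro mult_left_mono) simp_all
  then show "norm lam ^ Suc (Suc n) * norm (c (Suc (Suc n))) \<le> ?k * (norm lam ^ Suc n * norm (c (Suc n)))"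
    by (simp add: ac_simps)
next
  have "(\<lambda>n. sqrt K * (norm lam * x n + norm mu * (1 + x n)) * norm lam)
      \<longlonglongrightarrow> sqrt K * (norm lam * 0 + norm mu * (1 + 0)) * norm lam"
    by (intro tendsto_intros x_tendsto)
  then show "(\<lambda>n. sqrt K * (norm lam * x n + norm mu * (1 + x n)) * norm lam) \<longlonglongrightarrow> sqrt K"
    using norm_lam_mu by (simp add: mult.assoc mult.commute[of "norm mu"])
qed (simp_all add: K_less_1)

text \<open>The real part is invariant under cyclic permutation of a product, so the real part of
  the trace is a conjugation invariant although the quaternionic trace is not.\<close>

lemma qre_trace_Suc: "qre (a (Suc n)) + qre (d (Suc n)) = qre lam + qre mu"
proof -
  have cyc: "qre (p * q * r) = qre (q * (r * p))" for p q r
    by (simp add: mult.assoc qre_mult_commute[of p])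
  have "qre (a (Suc n)) + qre (d (Suc n))
      = qre (lam * (qadj (A n) $ 1 $ 1 * a n + qadj (A n) $ 1 $ 2 * c n))
        + qre (mu * (qadj (A n) $ 2 $ 1 * b n + qadj (A n) $ 2 $ 2 * d n))"
    unfolding entries_Suc by (simp add: cyc distrib_left)
  then show ?thesis
    by (simp add: inverse_entries)
qed

text \<open>If both entries of a row were nonzero, the vanishing off-diagonal entry would equate a
  conjugate of \<open>lam\<close> with one of \<open>mu\<close>. So each row has a zero, and
  determinant 1 forbids both zeros in one column.\<close>

lemma monomial_mat_pred:
  assumes "b (Suc n) = 0" "c (Suc n) = 0"
  shows "monomial_mat (A n)"
proof -
  have "a n = 0 \<or> b n = 0"
    using norm_b_Suc[of n] assms(1) not_similar conjugates_eq_imp_similar[of "a n" "b n" mu lam]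
    by (auto split: if_splits)
  moreover have "c n = 0 \<or> d n = 0"
    using norm_c_Suc[of n] assms(2) not_similar conjugates_eq_imp_similar[of "c n" "d n" mu lam]
    by (auto split: if_splits)
  moreover have "\<not> (a n = 0 \<and> c n = 0)" "\<not> (b n = 0 \<and> d n = 0)"
    using det[of n] by (auto simp: qdet_def Let_def)
  ultimately show ?thesis
    unfolding monomial_mat_def by blast
qed

text \<open>Descent from N to 0: each step back yields a monomial matrix, which must be diagonal for
  the descent to continue. Only at index 0 may it be antidiagonal.\<close>

lemma monomial_mat_0:
  assumes "b N = 0" "c N = 0"
  shows "monomial_mat (A 0)"
  using assms
proof (induction N)
  case 0
  then show ?case
    by (simp add: monomial_mat_def)
next
  case (Suc n)
  then have mon: "monomial_mat (A n)"
    using monomial_mat_pred by blast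
  show ?case
  proof (cases n)
    case 0
    then show ?thesis
      using mon by simp
  next
    case (Suc m)
    \<comment> \<open>At a positive index the real trace is that of T, which is nonzero, so the
      diagonal alternative remains and the induction hypothesis applies.\<close>
    then have "\<not> (a n = 0 \<and> d n = 0)"
      using qre_trace_Suc[of m] trace_nonzero by auto
    then show ?thesis
      using mon \<open>b n = 0 \<Longrightarrow> c n = 0 \<Longrightarrow> monomial_mat (A 0)\<close> unfolding monomial_mat_def by blast
  qed
qed

section \<open>Use of discreteness\<close>

lemma norm_a_Suc_bounded: "norm (a (Suc n)) \<le> norm lam * (1 + x 0) + norm mu * x 0"
proof -
  have "norm lam * (1 + x n) + norm mu * x n \<le> norm lam * (1 + x 0) + norm mu * x 0"
    by (intro add_mono mult_left_mono) (simp_all add: x_le)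
  then show ?thesis
    using norm_a_Suc_le[of n] by linarith
qed

lemma norm_d_Suc_bounded: "norm (d (Suc n)) \<le> norm lam * x 0 + norm mu * (1 + x 0)"
proof -
  have "norm lam * x n + norm mu * (1 + x n) \<le> norm lam * x 0 + norm mu * (1 + x 0)"
    by (intro add_mono mult_left_mono) (simp_all add: x_le)
  then show ?thesis
    using norm_d_Suc_le[of n] by linarith
qed

lemma discrete_imp_monomial_mat:
  assumes G: "subgroup G SL2H" "discrete G" and mem: "A 0 \<in> G" "qmat lam 0 0 mu \<in> G"
  shows "monomial_mat (A 0)"
proof -
  note sub = subgroup_SL2H[OF G(1)]
  have A_mem: "A n \<in> G" for n
    by (induction n) (simp_all add: mem A_Suc sub)
  define P where "P n = qmat (lam ^ n) 0 0 (mu ^ n)" for n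
  have P_mem: "P n \<in> G" for n
  proof (induction n)
    case 0
    have "P 0 = mat 1"
      by (rule qmat_eqI) (simp_all add: P_def)
    then show ?case
      by (simp add: sub)
  next
    case (Suc n)
    have "P (Suc n) = qmat lam 0 0 mu ** P n"
      by (rule qmat_eqI) (simp_all add: P_def)
    then show ?case
      by (simp add: sub mem Suc)
  qed
  \<comment> \<open>Conjugating by the m-th power of T multiplies |b| by |mu|^(2m) and |c| by
    |lam|^(2m), exactly the decaying weights at the even index 2m. Taking m = n + 1 keeps the index
    positive, so the bounds on the diagonal entries apply.\<close>
  define U where "U n = qadj (P (Suc n)) ** A (2 * Suc n) ** P (Suc n)" for n
  have U_mem: "U n \<in> G" for n
    unfolding U_def by (intro sub P_mem A_mem)
  have cancel: "norm lam ^ n * norm mu ^ n = 1" "norm mu ^ n * norm lam ^ n = 1" for n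
    using norm_lam_mu by (simp_all add: mult.commute flip: power_mult_distrib)
  have P_sel: "P n $ 1 $ 1 = lam ^ n" "P n $ 1 $ 2 = 0" "P n $ 2 $ 1 = 0" "P n $ 2 $ 2 = mu ^ n" for n
    by (simp_all add: P_def)
  have P_inv: "norm (qadj (P n) $ 1 $ 1) = norm mu ^ n" "norm (qadj (P n) $ 2 $ 2) = norm lam ^ n"
    "qadj (P n) $ 1 $ 2 = 0" "qadj (P n) $ 2 $ 1 = 0" for n
    using norm_qadj[OF sub(1)[OF P_mem[of n]]] by (simp_all add: P_sel norm_power)
  define \<beta> \<gamma> where "\<beta> n = norm mu ^ n * norm (b n)" and "\<gamma> n = norm lam ^ n * norm (c n)" for n
  have U_entries: "norm (U n $ 1 $ 1) = norm (a (2 * Suc n))" "norm (U n $ 1 $ 2) = \<beta> (2 * Suc n)"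
    "norm (U n $ 2 $ 1) = \<gamma> (2 * Suc n)" "norm (U n $ 2 $ 2) = norm (d (2 * Suc n))" for n
  proof -
    define m where "m = Suc n"
    have dbl: "y ^ (2 * m) = y ^ m * y ^ m" for y :: real
      by (simp add: mult_2 power_add)
    have "norm (U n $ 1 $ 1) = (norm lam ^ m * norm mu ^ m) * norm (a (2 * m))"
      by (simp add: U_def P_inv P_sel norm_mult norm_power flip: m_def)
    moreover have "norm (U n $ 2 $ 2) = (norm lam ^ m * norm mu ^ m) * norm (d (2 * m))"
      by (simp add: U_def P_inv P_sel norm_mult norm_power flip: m_def)
    moreover have "norm (U n $ 1 $ 2) = \<beta> (2 * m)" "norm (U n $ 2 $ 1) = \<gamma> (2 * m)"
      by (simp_all add: U_def P_inv P_sel norm_mult norm_power \<beta>_def \<gamma>_def dbl flip: m_def)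
    ultimately show "norm (U n $ 1 $ 1) = norm (a (2 * Suc n))" "norm (U n $ 1 $ 2) = \<beta> (2 * Suc n)"
      "norm (U n $ 2 $ 1) = \<gamma> (2 * Suc n)" "norm (U n $ 2 $ 2) = norm (d (2 * Suc n))"
      unfolding cancel m_def by simp_all
  qed
  have lim: "\<beta> \<longlonglongrightarrow> 0" "\<gamma> \<longlonglongrightarrow> 0"
    using b_tendsto c_tendsto by (simp_all add: \<beta>_def[abs_def] \<gamma>_def[abs_def])
  obtain B C where B: "\<And>n. \<beta> n \<le> B" and C: "\<And>n. \<gamma> n \<le> C"
    using convergent_imp_Bseq[OF convergentI[OF lim(1)]] convergent_imp_Bseq[OF convergentI[OF lim(2)]]
    unfolding Bseq_def by (auto simp: abs_le_iff)
  have "norm (U n) \<le> (norm lam * (1 + x 0) + norm mu * x 0) + B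
      + (C + (norm lam * x 0 + norm mu * (1 + x 0)))" for n
  proof -
    have "norm (U n) \<le> norm (U n $ 1) + norm (U n $ 2)"
      by (rule norm_vec2_le)
    also have "\<dots> \<le> (norm (U n $ 1 $ 1) + norm (U n $ 1 $ 2)) + (norm (U n $ 2 $ 1) + norm (U n $ 2 $ 2))"
      by (intro add_mono norm_vec2_le)
    also have "\<dots> \<le> (norm lam * (1 + x 0) + norm mu * x 0) + B
      + (C + (norm lam * x 0 + norm mu * (1 + x 0)))"
      unfolding U_entries
      using norm_a_Suc_bounded[of "Suc (2 * n)"] norm_d_Suc_bounded[of "Suc (2 * n)"]
      by (intro add_mono B C) simp_all
    finally show ?thesis .
  qed
  then obtain r L where r: "strict_mono r" and L: "\<forall>\<^sub>F n in sequentially. U (r n) = L"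
    using discrete_subgroup_subsequence[where U = U, OF G U_mem] by blast
  have "strict_mono (\<lambda>n. 2 * Suc (r n))"
    using r by (simp add: strict_mono_def)
  then have sublim: "(\<lambda>n. \<beta> (2 * Suc (r n))) \<longlonglongrightarrow> 0" "(\<lambda>n. \<gamma> (2 * Suc (r n))) \<longlonglongrightarrow> 0"
    using LIMSEQ_subseq_LIMSEQ[OF lim(1)] LIMSEQ_subseq_LIMSEQ[OF lim(2)] by (simp_all add: o_def)
  \<comment> \<open>Along the subsequence the off-diagonal norms are eventually constant, so their
    limit 0 is attained.\<close>
  have "(\<lambda>n. \<beta> (2 * Suc (r n))) \<longlonglongrightarrow> norm (L $ 1 $ 2)" "(\<lambda>n. \<gamma> (2 * Suc (r n))) \<longlonglongrightarrow> norm (L $ 2 $ 1)"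
    unfolding U_entries[symmetric] using L by (auto intro!: tendsto_eventually elim: eventually_mono)
  then have "L $ 1 $ 2 = 0" "L $ 2 $ 1 = 0"
    using LIMSEQ_unique sublim by (metis norm_eq_zero)+
  then obtain n where "U n $ 1 $ 2 = 0" "U n $ 2 $ 1 = 0"
    using L unfolding eventually_sequentially by blast
  then have "b (2 * Suc n) = 0" "c (2 * Suc n) = 0"
    using U_entries(2,3)[of n] nonzero by (simp_all add: \<beta>_def \<gamma>_def del: mult_Suc_right)
  then show ?thesis
    by (rule monomial_mat_0)
qed

end

text \<open>Opposite real parts have a nonpositive product, and both sines are nonnegative on
  [0, pi]. This serves to show that a vanishing real trace would make \<open>K\<close> at least
  2.\<close>

lemma cos_qarg_add_nonpos:
  assumes "p \<noteq> 0" "q \<noteq> 0" "qre p + qre q = 0"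
  shows "norm p * norm q * cos (qarg p + qarg q) \<le> 0"
proof -
  have "norm p * norm q * cos (qarg p + qarg q)
      = qre p * qre q - norm p * norm q * (sin (qarg p) * sin (qarg q))"
    by (simp add: cos_add right_diff_distrib qarg(3)[OF assms(1)] qarg(3)[OF assms(2)] ac_simps)
  moreover have "qre p * qre q \<le> 0"
    using assms(3) by (simp add: eq_neg_iff_add_eq_0[symmetric])
  moreover have "0 \<le> norm p * norm q * (sin (qarg p) * sin (qarg q))"
    using qarg[OF assms(1)] qarg[OF assms(2)] by (intro mult_nonneg_nonneg) (simp_all add: sin_ge_zero)
  ultimately show ?thesis
    by simp
qed

lemma cosh_two_ln:
  assumes "r * s = (1 :: real)" "r > 0"
  shows "2 * cosh (2 * ln r) = r\<^sup>2 + s\<^sup>2"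
proof -
  have "s = inverse r"
    using assms by (simp add: field_simps)
  moreover have "exp (2 * ln r) = r\<^sup>2" "exp (- (2 * ln r)) = (inverse r)\<^sup>2"
    using assms(2) by (simp_all add: exp_minus exp_double power_inverse)
  ultimately show ?thesis
    by (simp add: cosh_def)
qed

theorem corollary3p2:
  fixes a b c d lam mu :: quat and S T :: "quat^2^2" and \<alpha> \<beta> \<tau> :: real
  assumes "S = qmat a b c d" and "T = qmat lam 0 0 mu"
    and "S \<in> carrier SL2H" and "T \<in> carrier SL2H"
    and "\<not> similar lam mu"
    and "discrete (generate SL2H {S, T})"
    and "\<not> elementary (generate SL2H {S, T})"
    and "\<alpha> = qarg lam" and "\<beta> = qarg mu" and "\<tau> = 2 * ln (norm lam)"
  shows "2 * (cosh \<tau> - cos (\<alpha> + \<beta>)) * (1 + norm (b * c)) \<ge> 1"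
proof (rule ccontr)
  assume neg: "\<not> 2 * (cosh \<tau> - cos (\<alpha> + \<beta>)) * (1 + norm (b * c)) \<ge> 1"
  define K where "K = (norm lam)\<^sup>2 + (norm mu)\<^sup>2 - 2 * norm lam * norm mu * cos (qarg lam + qarg mu)"
  have prod: "norm lam * norm mu = 1"
    using assms(2,4) by (simp add: qdet_def flip: power_mult_distrib)
  then have nz: "lam \<noteq> 0" "mu \<noteq> 0"
    by auto
  \<comment> \<open>Since |lam| |mu| = 1, twice cosh tau is |lam|^2 + |mu|^2, so the bound of
    \<open>norm_diff_le_qarg\<close> is exactly the constant of the theorem.\<close>
  have "2 * (cosh \<tau> - cos (\<alpha> + \<beta>)) = K"
    using cosh_two_ln[OF prod] nz prod by (simp add: K_def assms(8-10) mult.assoc)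
  with neg have small: "K * (1 + norm b * norm c) < 1"
    by (simp add: norm_mult)
  define A where "A n = ((\<lambda>X. X ** T ** qadj X) ^^ n) S" for n
  interpret conjugation_iteration lam mu K A
  proof
    show "norm lam * norm mu = 1" "\<not> similar lam mu"
      using prod assms(5) .
    show bound: "(norm (v * mu * inverse v - u * lam * inverse u))\<^sup>2 \<le> K" if "u \<noteq> 0" "v \<noteq> 0" for u v
      unfolding K_def using norm_diff_conjugates_le[OF nz that] .
    \<comment> \<open>\<open>K\<close> is nonnegative because it bounds a square, here with u = v =
      1.\<close>
    have "K * 1 \<le> K * (1 + norm b * norm c)"
      using order_trans[OF zero_le_power2 bound[of 1 1]] by (intro mult_left_mono) simp_all
    then have "K < 1"
      using small by simp
    moreover have "2 * (norm lam * norm mu) \<le> (norm lam)\<^sup>2 + (norm mu)\<^sup>2"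
      using sum_squares_bound[of "norm lam" "norm mu"] by (simp add: mult.assoc)
    \<comment> \<open>Real trace 0 would give K \<ge> |lam|^2 + |mu|^2 \<ge> 2 |lam| |mu| = 2,
      against K < 1.\<close>
    ultimately show "qre lam + qre mu \<noteq> 0"
      using cos_qarg_add_nonpos[OF nz] prod unfolding K_def by (auto simp: mult.assoc)
    show "qdet (A 0) = 1" "K * (1 + norm (A 0 $ 1 $ 2) * norm (A 0 $ 2 $ 1)) < 1"
      using assms(1,3) small by (simp_all add: A_def)
    show "A (Suc n) = A n ** qmat lam 0 0 mu ** qadj (A n)" for n
      by (simp add: A_def assms(2))
  qed
  have carrier: "{S, T} \<subseteq> carrier SL2H"
    using assms(3,4) by simp
  have "monomial_mat (A 0)"
  proof (rule discrete_imp_monomial_mat)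
    show "subgroup (generate SL2H {S, T}) SL2H"
      by (rule group.generate_is_subgroup[OF group_SL2H carrier])
    show "discrete (generate SL2H {S, T})"
      by (rule assms(6))
    show "A 0 \<in> generate SL2H {S, T}" "qmat lam 0 0 mu \<in> generate SL2H {S, T}"
      by (auto simp: A_def assms(2) intro: generate.incl)
  qed
  then have "monomial_mat S"
    by (simp add: A_def)
  moreover have "monomial_mat T"
    by (simp add: assms(2) monomial_mat_def)
  ultimately have "elementary (generate SL2H {S, T})"
    using elementary_generate_monomial[OF carrier] by blast
  with assms(7) show False
    by blast
qed

end
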